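(* Assume $I_S\neq\emptyset$ and suppose that every optimal solution to the following problem uses at most one item copy from $\tilde I_\kappa$: maximize the profit of a multiset of items from $G\cup\{a_{eff}\}$ of total size at most $c$ that contains, for each $k\in\{0,\dots,\kappa-1\}$, at most one item copy from $\tilde I_k$. Then there is a value $0\le v\le c$ such that $$\mathrm{OPT}^S_v(G\cup\{a_{eff}^c\})+\mathrm{OPT}_{c-v}(\{a_{eff}\})\ \ge\ \left(1-\frac{\varepsilon}{4}\cdot\frac{1}{\log_2(2/\varepsilon)+1}\right)^{\kappa+1}\mathrm{OPT}(I)-T.$$
   Context: UKP instance $I$: items with profits $p(a)\in(0,1]$, sizes $s(a)\in(0,1]$, capacity $c=1$; for a set $I'$ of items and $0\le v\le c$, $\mathrm{OPT}_v(I')=\max\{\sum p(a)x_a:\sum s(a)x_a\le v,\ x_a\in\mathbb{N}\}$, $\mathrm{OPT}(I')=\mathrm{OPT}_c(I')$. Let $\varepsilon=1/2^{\kappa-1}$, $\kappa\in\mathbb{N}$, $\varepsilon\le1/4$. Let $a_{me}$ maximize $p/s$ over $I$, $P_0=p(a_{me})\lfloor c/s(a_{me})\rfloor$, $T=\frac12\varepsilon P_0$, $K=\frac14\cdot\frac1{\kappa+1}\varepsilon T$, $I_L=\{a\in I:p(a)\ge T\}$, $I_S=I\setminus I_L$, $a_{eff}$ an item of $I_S$ maximizing $p/s$. Standing assumption: $I$ contains no item of profit $2P_0$. For $k\in\{0,\dots,\kappa\}$, $L_k=[2^kT,2^{k+1}T)$ and for $\gamma\in\{0,\dots,2^{\kappa+1}(\kappa+1)-1\}$,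 $L_{k,\gamma}=[2^kT+\gamma2^kK,\ 2^kT+(\gamma+1)2^kK)$. $a_{k,\gamma}$ is an item of minimum size among items of $I_L$ with profit in $L_{k,\gamma}$ (if any); $I_L^{red}$ is the set of all existing $a_{k,\gamma}$; $I_k=\{a\in I_L^{red}:p(a)\in L_k\}$. Gluing: for items $a_1,a_2$ with $s(a_1)+s(a_2)\le c$, $a_1\oplus a_2$ is an item of profit $p(a_1)+p(a_2)$ and size $s(a_1)+s(a_2)$ (glued items are treated as ordinary items). $\tilde I_0=I_0$; for $k=0,\dots,\kappa-1$ and each $\gamma$, $\tilde a_{k+1,\gamma}$ is an item of minimum size among the items of $I_{k+1}\cup\{\tilde a\oplus\tilde a':\tilde a,\tilde a'\in\tilde I_k,\ s(\tilde a)+s(\tilde a')\le c\}$ with profit in $L_{k+1,\gamma}$ (if any), and $\tilde I_{k+1}$ is the set of existing $\tilde a_{k+1,\gamma}$. $G=\bigcup_{k=0}^{\kappa}\tilde I_k$. Let $m=\lceil (P_0/4)/p(a_{eff})\rceil$; if $m$ copies of $a_{eff}$ have total size at most $c$, $a_{eff}^c$ is the item of profit $m\,p(a_{eff})$ and size $m\,s(a_{eff})$ (these copies glued together); otherwise $a_{eff}^c$ does not exist and $G\cup\{a_{eff}^c\}$ means $G$. Structured solutions with a lower bound: for $v\le c$, $\mathrm{OPT}^S_v(G\cup\{a_{eff}^c\})$ is the maximum profit of a multiset of items from $G\cup\{a_{eff}^c\}$ of total size at most $v$ that uses at most one item copy from each $\tilde I_k$ ($k=0,\dots,\kappa$), at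 most one copy of $a_{eff}^c$, and at least one item copy from $\tilde I_{\kappa-2}\cup\tilde I_{\kappa-1}\cup\tilde I_\kappa\cup\{a_{eff}^c\}$; it is $0$ if no such multiset exists. *)

theory Defs
  imports Complex_Main "HOL-Library.Multiset"
begin

(* Capacity v; for finite A, positive s and v \<ge> 0 the set of profits is finite and
   non-empty, so Max is the genuine maximum. *)
definition opt :: "('b \<Rightarrow> real) \<Rightarrow> ('b \<Rightarrow> real) \<Rightarrow> real \<Rightarrow> 'b set \<Rightarrow> real" where
  "opt p s v A =
     Max {\<Sum>a\<in>A. p a * real (x a) | x :: 'b \<Rightarrow> nat. (\<Sum>a\<in>A. s a * real (x a)) \<le> v}"

(* Items keep their identity rather than being identified with their (profit, size) pair:
   the item Copies m a must remain distinct from a Glue item that happens to have the same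
   profit and size, as their numbers of copies are restricted separately. *)
datatype 'a item =
    Orig 'a
  | Glue "'a item" "'a item"
  | Copies nat "'a item"

(* Additive extension to glued items, used for both profit and size. *)
primrec item_val :: "('a \<Rightarrow> real) \<Rightarrow> 'a item \<Rightarrow> real" where
  "item_val f (Orig a) = f a"
| "item_val f (Glue x y) = item_val f x + item_val f y"
| "item_val f (Copies n x) = real n * item_val f x"

definition mset_val :: "('b \<Rightarrow> real) \<Rightarrow> 'b multiset \<Rightarrow> real" where
  "mset_val f M = (\<Sum>a\<in>#M. f a)"

definition copies_from :: "'b set \<Rightarrow> 'b multiset \<Rightarrow> nat" where
  "copies_from A M = size (filter_mset (\<lambda>a. a \<in> A) M)"

definition profit_level :: "real \<Rightarrow> nat \<Rightarrow> real set" where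
  "profit_level T k = {2 ^ k * T ..< 2 ^ (k + 1) * T}"

definition profit_sublevel :: "real \<Rightarrow> real \<Rightarrow> nat \<Rightarrow> nat \<Rightarrow> real set" where
  "profit_sublevel T K k \<gamma> =
     {2 ^ k * T + real \<gamma> * 2 ^ k * K ..< 2 ^ k * T + (real \<gamma> + 1) * 2 ^ k * K}"

(* x is some item of minimum size in A (ties broken arbitrarily), None iff there is none. *)
definition min_size_choice :: "('b \<Rightarrow> real) \<Rightarrow> 'b set \<Rightarrow> 'b option \<Rightarrow> bool" where
  "min_size_choice s A x \<longleftrightarrow>
     (case x of None \<Rightarrow> A = {} | Some a \<Rightarrow> is_arg_min s (\<lambda>b. b \<in> A) a)"

(* The two components of a pair may be the same item. *)
definition glued_pairs :: "('a \<Rightarrow> real) \<Rightarrow> 'a item set \<Rightarrow> 'a item set" where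
  "glued_pairs s A = {Glue x y | x y. x \<in> A \<and> y \<in> A \<and> item_val s x + item_val s y \<le> 1}"

(* J k is the k-th level, E the set holding the glued efficient item, or empty. *)
definition structured ::
  "('a \<Rightarrow> real) \<Rightarrow> nat \<Rightarrow> (nat \<Rightarrow> 'a item set) \<Rightarrow> 'a item set \<Rightarrow> real \<Rightarrow> 'a item multiset \<Rightarrow> bool"
where
  "structured s \<kappa> J E v M \<longleftrightarrow>
     set_mset M \<subseteq> (\<Union>k\<le>\<kappa>. J k) \<union> E \<and>
     mset_val (item_val s) M \<le> v \<and>
     (\<forall>k\<le>\<kappa>. copies_from (J k) M \<le> 1) \<and>
     copies_from E M \<le> 1 \<and>
     copies_from (J (\<kappa> - 2) \<union> J (\<kappa> - 1) \<union> J \<kappa> \<union> E) M \<ge> 1"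

definition opt_structured ::
  "('a \<Rightarrow> real) \<Rightarrow> ('a \<Rightarrow> real) \<Rightarrow> nat \<Rightarrow> (nat \<Rightarrow> 'a item set) \<Rightarrow> 'a item set \<Rightarrow> real \<Rightarrow> real"
where
  "opt_structured p s \<kappa> J E v =
     (if \<exists>M. structured s \<kappa> J E v M
      then Max {mset_val (item_val p) M | M. structured s \<kappa> J E v M}
      else 0)"

end

theory Submission
  imports Defs
begin

text \<open>
  Put \<open>\<delta> = \<epsilon> / (4 (\<kappa> + 1))\<close>, so that \<open>K = \<delta> T\<close> and \<open>2 ^ \<kappa> T = P0\<close>. Exchanging an item for the
  smallest one of the same sublevel costs at most the fraction \<open>\<delta>\<close> of its profit. Starting from an
  optimal solution, exchange the large items for reduced ones and then, level by level, glue items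
  in pairs and exchange the results; these \<open>\<kappa> + 1\<close> rounds cost the factor \<open>(1 - \<delta>) ^ (\<kappa> + 1)\<close>.
  Filling the room of the small items with \<open>a_eff\<close> costs at most \<open>p a_eff < T\<close>. Hence an optimal
  solution of the restricted problem is good enough. If it has no item on the three top levels, its
  large items have total profit at most \<open>P0 / 2 - 2 T\<close>, whereas its profit is at least
  \<open>P0 - 3 T / 2\<close> by Bernoulli's inequality; so it has at least \<open>m\<close> copies of \<open>a_eff\<close>, which can
  be glued.
\<close>

section \<open>Values and copy counts of multisets\<close>

lemma mset_val_empty [simp]: "mset_val f {#} = 0"
  by (simp add: mset_val_def)

lemma mset_val_add [simp]: "mset_val f (add_mset a M) = f a + mset_val f M"
  by (simp add: mset_val_def)

lemma mset_val_union [simp]: "mset_val f (M + N) = mset_val f M + mset_val f N"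
  by (simp add: mset_val_def)

lemma mset_val_replicate [simp]: "mset_val f (replicate_mset n a) = real n * f a"
  by (induction n) (simp_all add: algebra_simps)

lemma mset_val_image: "mset_val f (image_mset h M) = mset_val (f \<circ> h) M"
  by (induction M) simp_all

lemma mset_val_mono:
  "(\<And>x. x \<in># M \<Longrightarrow> f x \<le> h x) \<Longrightarrow> mset_val f M \<le> mset_val h M"
  by (induction M) (auto intro: add_mono)

lemma mset_val_cmult: "mset_val (\<lambda>x. c * f x) M = c * mset_val f M"
  by (induction M) (simp_all add: algebra_simps)

lemma mset_val_const: "mset_val (\<lambda>_. c) M = c * real (size M)"
  by (induction M) (simp_all add: algebra_simps)

lemma mset_val_nonneg:
  "(\<And>x. x \<in># M \<Longrightarrow> 0 \<le> f x) \<Longrightarrow> 0 \<le> mset_val f M"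
  by (induction M) auto

lemma mset_val_filter_split:
  "mset_val f M = mset_val f (filter_mset Q M) + mset_val f (filter_mset (\<lambda>x. \<not> Q x) M)"
  by (induction M) auto

lemma mset_val_eq_sum:
  assumes "finite A" "set_mset M \<subseteq> A"
  shows "mset_val f M = (\<Sum>a\<in>A. f a * real (count M a))"
  using assms(2)
proof (induction M)
  case (add x M)
  have "(\<Sum>a\<in>A. f a * real (count (add_mset x M) a))
      = (\<Sum>a\<in>A. f a * real (count M a) + (if a = x then f a else 0))"
    by (intro sum.cong) (auto simp: algebra_simps)
  also have "\<dots> = mset_val f M + f x"
    using add assms(1) by (simp add: sum.distrib)
  finally show ?case by simp
qed simp

lemma copies_from_empty [simp]: "copies_from A {#} = 0"
  by (simp add: copies_from_def)

lemma copies_from_add [simp]: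
  "copies_from A (add_mset x M) = (if x \<in> A then 1 else 0) + copies_from A M"
  by (simp add: copies_from_def)

lemma copies_from_union [simp]: "copies_from A (M + N) = copies_from A M + copies_from A N"
  by (simp add: copies_from_def)

lemma copies_from_le_size: "copies_from A M \<le> size M"
  by (simp add: copies_from_def size_filter_mset_lesseq)

lemma copies_from_eq_0_iff: "copies_from A M = 0 \<longleftrightarrow> set_mset M \<inter> A = {}"
  by (induction M) auto

lemma copies_from_filter_le: "copies_from A (filter_mset Q M) \<le> copies_from A M"
  by (induction M) auto

section \<open>Finiteness and attainment of the optima\<close>

text \<open>On a finite \<open>A\<close> the positive sizes have a positive lower bound
  \<open>d\<close>, so a multiset of total size at most \<open>v\<close> has at most
  \<open>v / d\<close> elements.\<close>

lemma finite_bounded_multisets: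
  assumes "finite A" "\<And>a. a \<in> A \<Longrightarrow> 0 < s a"
  shows "finite {M. set_mset M \<subseteq> A \<and> mset_val s M \<le> v}"
proof -
  obtain d where d: "0 < d" "\<And>a. a \<in> A \<Longrightarrow> d \<le> s a"
  proof
    \<comment> \<open>Inserting \<open>1\<close> keeps the minimum meaningful when \<open>A\<close>
      is empty.\<close>
    show "0 < Min (insert 1 (s ` A))" using assms by auto
    show "\<And>a. a \<in> A \<Longrightarrow> Min (insert 1 (s ` A)) \<le> s a" using assms by (auto intro: Min_le)
  qed
  have "{M. set_mset M \<subseteq> A \<and> mset_val s M \<le> v}
      \<subseteq> mset ` {xs. set xs \<subseteq> A \<and> length xs \<le> nat \<lfloor>v / d\<rfloor>}"
  proof safe
    fix M assume M: "set_mset M \<subseteq> A" "mset_val s M \<le> v"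
    obtain xs where xs: "M = mset xs" by (metis ex_mset)
    have "mset_val (\<lambda>_. d) M \<le> mset_val s M"
      using M d by (intro mset_val_mono) auto
    hence "real (size M) \<le> v / d"
      using M d by (simp add: mset_val_const field_simps)
    hence "size M \<le> nat \<lfloor>v / d\<rfloor>" by (simp add: le_nat_floor)
    with xs M show "M \<in> mset ` {xs. set xs \<subseteq> A \<and> length xs \<le> nat \<lfloor>v / d\<rfloor>}" by auto
  qed
  thus ?thesis
    using finite_imageI[OF finite_lists_length_le[OF assms(1)]] by (rule finite_subset)
qed

text \<open>Passes from multiplicity functions to multisets, on which exchanging and gluing items
  are easy to express. Multiplicities outside \<open>A\<close> do not affect either sum, so a
  function corresponds to the multiset of its values on \<open>A\<close>.\<close>

lemma opt_eq_Max_mset: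
  assumes "finite A"
  shows "opt p s v A = Max (mset_val p ` {M. set_mset M \<subseteq> A \<and> mset_val s M \<le> v})"
proof -
  have "{\<Sum>a\<in>A. p a * real (x a) | x :: 'a \<Rightarrow> nat. (\<Sum>a\<in>A. s a * real (x a)) \<le> v}
      = mset_val p ` {M. set_mset M \<subseteq> A \<and> mset_val s M \<le> v}" (is "?L = ?R")
  proof
    show "?L \<subseteq> ?R"
    proof safe
      fix x :: "'a \<Rightarrow> nat"
      assume x: "(\<Sum>a\<in>A. s a * real (x a)) \<le> v"
      define M where "M = (\<Sum>a\<in>A. replicate_mset (x a) a)"
      have sub: "set_mset M \<subseteq> A"
        by (auto simp: M_def set_mset_sum assms split: if_splits)
      have "count M a = x a" if "a \<in> A" for a
        using that assms by (simp add: M_def count_sum)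
      hence "mset_val f M = (\<Sum>a\<in>A. f a * real (x a))" for f
        using mset_val_eq_sum[OF assms sub, of f] by simp
      with x sub show "(\<Sum>a\<in>A. p a * real (x a)) \<in> ?R"
        by (intro image_eqI[where x = M]) auto
    qed
    show "?R \<subseteq> ?L"
      using mset_val_eq_sum[OF assms] by force
  qed
  thus ?thesis by (simp add: opt_def)
qed

lemma opt_ge_mset_val:
  assumes "finite A" "\<And>a. a \<in> A \<Longrightarrow> 0 < s a" "set_mset M \<subseteq> A" "mset_val s M \<le> v"
  shows "mset_val p M \<le> opt p s v A"
  using assms finite_bounded_multisets[of A s v, OF assms(1,2)]
  by (auto simp: opt_eq_Max_mset intro: Max_ge)

lemma opt_attained:
  assumes "finite A" "\<And>a. a \<in> A \<Longrightarrow> 0 < s a" "0 \<le> v"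
  obtains M where "set_mset M \<subseteq> A" "mset_val s M \<le> v" "mset_val p M = opt p s v A"
proof -
  have "{#} \<in> {M. set_mset M \<subseteq> A \<and> mset_val s M \<le> v}" using assms by simp
  hence "opt p s v A \<in> mset_val p ` {M. set_mset M \<subseteq> A \<and> mset_val s M \<le> v}"
    unfolding opt_eq_Max_mset[OF assms(1)]
    using finite_bounded_multisets[of A s v, OF assms(1,2)]
    by (intro Max_in) (blast intro: finite_imageI)+
  with that show thesis by auto
qed

text \<open>Positive sizes leave only finitely many structured multisets, so the \<open>Max\<close>
  is taken over a finite set.\<close>

lemma opt_structured_ge_mset_val:
  assumes "finite ((\<Union>k\<le>\<kappa>. J k) \<union> E)" "\<And>x. x \<in> (\<Union>k\<le>\<kappa>. J k) \<union> E \<Longrightarrow> 0 < item_val s x"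
    "structured s \<kappa> J E v M"
  shows "mset_val (item_val p) M \<le> opt_structured p s \<kappa> J E v"
proof -
  have "{mset_val (item_val p) M | M. structured s \<kappa> J E v M} \<subseteq> mset_val (item_val p) `
      {M. set_mset M \<subseteq> (\<Union>k\<le>\<kappa>. J k) \<union> E \<and> mset_val (item_val s) M \<le> v}"
    by (auto simp: structured_def)
  hence "finite {mset_val (item_val p) M | M. structured s \<kappa> J E v M}"
    using finite_bounded_multisets[of "(\<Union>k\<le>\<kappa>. J k) \<union> E" "item_val s" v, OF assms(1,2)]
      finite_subset finite_imageI by blast
  thus ?thesis using assms(3) by (auto simp: opt_structured_def intro!: Max_ge)
qed

section \<open>Profit levels, their sublevels and the exchange of one item\<close>

lemma profit_level_disjoint:
  assumes "0 < T" "i < j"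
  shows "profit_level T i \<inter> profit_level T j = {}"
proof -
  have "(2::real) ^ (i + 1) \<le> 2 ^ j" using assms by (intro power_increasing) auto
  hence "2 ^ (i + 1) * T \<le> 2 ^ j * T" using assms by (intro mult_right_mono) auto
  thus ?thesis by (auto simp: profit_level_def)
qed

lemma profit_level_cover:
  assumes "T \<le> y" "y < 2 ^ (n + 1) * T"
  shows "\<exists>k\<le>n. y \<in> profit_level T k"
  using assms(2)
proof (induction n)
  case 0
  thus ?case using assms(1) by (auto simp: profit_level_def)
next
  case (Suc n)
  show ?case
  proof (cases "y < 2 ^ (n + 1) * T")
    case True
    thus ?thesis using Suc.IH le_SucI by blast
  next
    case False
    thus ?thesis using Suc.prems by (intro exI[of _ "Suc n"]) (auto simp: profit_level_def)
  qed
qed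

text \<open>The \<open>n\<close> sublevels have width \<open>2 ^ k * K\<close> each, and
  \<open>n\<close> such widths make up exactly the length \<open>2 ^ k * T\<close> of the
  level.\<close>

lemma profit_sublevel_subset:
  assumes "0 \<le> K" "real n * K = T" "\<gamma> < n"
  shows "profit_sublevel T K k \<gamma> \<subseteq> profit_level T k"
proof -
  have "(real \<gamma> + 1) * K \<le> real n * K" using assms by (intro mult_right_mono) auto
  hence "2 ^ k * ((real \<gamma> + 1) * K) \<le> 2 ^ k * T" using assms by (intro mult_left_mono) auto
  moreover have "0 \<le> real \<gamma> * 2 ^ k * K" using assms by simp
  ultimately show ?thesis
    by (auto simp: profit_level_def profit_sublevel_def algebra_simps)
qed

lemma profit_sublevel_cover:
  assumes "0 < K" "real n * K = T" "y \<in> profit_level T k"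
  shows "\<exists>\<gamma><n. y \<in> profit_sublevel T K k \<gamma>"
proof -
  \<comment> \<open>The offset of \<open>y\<close> within its level, measured in sublevel widths;
    its floor is the required index.\<close>
  define z where "z = (y - 2 ^ k * T) / (2 ^ k * K)"
  have y: "y = 2 ^ k * T + z * 2 ^ k * K" using assms by (simp add: z_def)
  have "0 \<le> z" using assms by (auto simp: z_def profit_level_def)
  have "z * (2 ^ k * K) < real n * (2 ^ k * K)"
  proof -
    have "y < 2 ^ k * T + 2 ^ k * T" using assms(3) by (simp add: profit_level_def mult.commute)
    moreover have "real n * (2 ^ k * K) = 2 ^ k * T" using assms(2) by auto
    ultimately show ?thesis using y by simp
  qed
  hence zn: "z < real n" using assms(1) by (simp only: mult_less_cancel_right) auto
  have fl: "real (nat \<lfloor>z\<rfloor>) \<le> z" "z < real (nat \<lfloor>z\<rfloor>) + 1"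
    using \<open>0 \<le> z\<close> by linarith+
  have "real (nat \<lfloor>z\<rfloor>) * (2 ^ k * K) \<le> z * (2 ^ k * K)"
    using fl assms by (intro mult_right_mono) auto
  moreover have "z * (2 ^ k * K) < (real (nat \<lfloor>z\<rfloor>) + 1) * (2 ^ k * K)"
    using fl assms by (intro mult_strict_right_mono) auto
  ultimately have "y \<in> profit_sublevel T K k (nat \<lfloor>z\<rfloor>)"
    using y by (auto simp: profit_sublevel_def mult.assoc)
  moreover have "nat \<lfloor>z\<rfloor> < n" using fl zn by linarith
  ultimately show ?thesis by blast
qed

text \<open>A sublevel has width \<open>2 ^ k * K = \<delta> * (2 ^ k * T)\<close>, which is at most
  the fraction \<open>\<delta>\<close> of any profit on level \<open>k\<close>.\<close>

lemma profit_sublevel_ratio: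
  assumes "0 \<le> \<delta>" "0 \<le> T" "K = \<delta> * T" "y \<in> profit_sublevel T K k \<gamma>"
    "y' \<in> profit_sublevel T K k \<gamma>"
  shows "(1 - \<delta>) * y \<le> y'"
proof -
  have "0 \<le> real \<gamma> * 2 ^ k * K" using assms by simp
  moreover have "2 ^ k * T + real \<gamma> * 2 ^ k * K \<le> y"
    using assms(4) by (simp add: profit_sublevel_def)
  ultimately have "2 ^ k * T \<le> y" by simp
  hence "\<delta> * (2 ^ k * T) \<le> \<delta> * y" using assms by (intro mult_left_mono)
  hence "2 ^ k * K \<le> \<delta> * y" by (simp add: assms(3) mult.left_commute)
  moreover have "y < 2 ^ k * T + real \<gamma> * 2 ^ k * K + 2 ^ k * K"
    "2 ^ k * T + real \<gamma> * 2 ^ k * K \<le> y'"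
    using assms(4,5) by (auto simp: profit_sublevel_def algebra_simps)
  ultimately show ?thesis by (simp add: algebra_simps)
qed

text \<open>One exchange: the sublevel containing the profit of \<open>x\<close> is inhabited, so an
  item was chosen there, no larger than \<open>x\<close> and of nearly the same profit. It serves
  both the reduction of the large items and the choice after gluing.\<close>

lemma min_size_choice_replace:
  assumes "0 < \<delta>" "0 < T" "K = \<delta> * T" "real n * K = T"
    and choice: "\<And>\<gamma>. \<gamma> < n \<Longrightarrow> min_size_choice s {x \<in> A. p x \<in> profit_sublevel T K k \<gamma>} (h \<gamma>)"
    and x: "x \<in> A" "p x \<in> profit_level T k"
  shows "\<exists>\<gamma><n. \<exists>z. h \<gamma> = Some z \<and> s z \<le> s x \<and> (1 - \<delta>) * p x \<le> p z"
proof -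
  have "0 < K" using assms by simp
  then obtain \<gamma> where \<gamma>: "\<gamma> < n" "p x \<in> profit_sublevel T K k \<gamma>"
    using profit_sublevel_cover assms x by metis
  with choice[of \<gamma>] x obtain z where z: "h \<gamma> = Some z"
    "is_arg_min s (\<lambda>b. b \<in> {x \<in> A. p x \<in> profit_sublevel T K k \<gamma>}) z"
    by (cases "h \<gamma>") (auto simp: min_size_choice_def)
  hence "s z \<le> s x" "p z \<in> profit_sublevel T K k \<gamma>"
    using x \<gamma> by (auto simp: is_arg_min_def not_less)
  with \<gamma> z show ?thesis
    using profit_sublevel_ratio[of \<delta> T K "p x" k \<gamma> "p z"] assms by auto
qed

lemma min_size_choiceD:
  assumes "0 \<le> K" "real n * K = T" "\<gamma> < n"
    "min_size_choice s {x \<in> A. p x \<in> profit_sublevel T K k \<gamma>} (Some z)"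
  shows "z \<in> A" "p z \<in> profit_level T k"
  using assms profit_sublevel_subset[OF assms(1-3), of k]
  by (auto simp: min_size_choice_def is_arg_min_def)

section \<open>Exchanging and gluing the items of a multiset\<close>

text \<open>Exchanges made item by item add up: \<open>N\<close> is the image of \<open>D\<close>
  under a choice of replacements, with multiplicities kept.\<close>

lemma mset_replace:
  assumes "\<And>x. x \<in># D \<Longrightarrow> \<exists>z\<in>Z. s' z \<le> s x \<and> c * p x \<le> p' z"
  obtains N where "set_mset N \<subseteq> Z" "mset_val s' N \<le> mset_val s D"
    "c * mset_val p D \<le> mset_val p' N"
proof -
  obtain f where f: "\<And>x. x \<in># D \<Longrightarrow> f x \<in> Z \<and> s' (f x) \<le> s x \<and> c * p x \<le> p' (f x)"
    using assms by metis
  show thesis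
  proof
    show "set_mset (image_mset f D) \<subseteq> Z" using f by auto
    show "mset_val s' (image_mset f D) \<le> mset_val s D"
      unfolding mset_val_image using f by (intro mset_val_mono) auto
    show "c * mset_val p D \<le> mset_val p' (image_mset f D)"
      unfolding mset_val_image mset_val_cmult[symmetric] using f by (intro mset_val_mono) auto
  qed
qed

text \<open>The items are processed one at a time, with \<open>R\<close> holding the unpaired one,
  if any. A new item is glued to it or becomes the unpaired one itself; values are preserved because
  \<open>item_val\<close> is additive.\<close>

lemma mset_pairing:
  assumes nonneg: "\<And>x. x \<in> X \<Longrightarrow> 0 \<le> item_val s x"
    and "set_mset B \<subseteq> X" "mset_val (item_val s) B \<le> 1"
  shows "\<exists>D R. set_mset D \<subseteq> glued_pairs s X \<and> set_mset R \<subseteq> X \<and> size R \<le> 1 \<and>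
    (\<forall>f. mset_val (item_val f) (D + R) = mset_val (item_val f) B)"
  using assms(2,3)
proof (induction B)
  case empty
  show ?case by (intro exI[of _ "{#}"]) simp
next
  case (add x B)
  from add.prems have "set_mset B \<subseteq> X" "mset_val (item_val s) B \<le> 1"
    using nonneg[of x] by auto
  from add.IH[OF this] obtain D R where DR: "set_mset D \<subseteq> glued_pairs s X" "set_mset R \<subseteq> X"
    "size R \<le> 1" and val: "\<And>f. mset_val (item_val f) (D + R) = mset_val (item_val f) B"
    by blast
  show ?case
  proof (cases "R = {#}")
    case True
    with DR val add.prems show ?thesis
      by (intro exI[of _ D] exI[of _ "{#x#}"]) auto
  next
    case False
    with DR(3) have "size R = 1" by (simp add: nonempty_has_size le_Suc_eq)
    then obtain y where R: "R = {#y#}" by (metis size_1_singleton_mset)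
    \<comment> \<open>Since the remaining items have nonnegative size, the bound on the total size
      shows that the pair \<open>x\<close>, \<open>y\<close> fits by itself.\<close>
    have "0 \<le> mset_val (item_val s) D"
      using DR(1) nonneg by (intro mset_val_nonneg) (force simp: glued_pairs_def)
    hence "item_val s x + item_val s y \<le> 1"
      using val[of s] add.prems R by simp
    hence "Glue x y \<in> glued_pairs s X"
      using DR(2) R add.prems by (auto simp: glued_pairs_def)
    moreover have "mset_val (item_val f) (add_mset (Glue x y) D + {#})
        = mset_val (item_val f) (add_mset x B)" for f
      using val[of f] R by simp
    ultimately show ?thesis using DR(1)
      by (intro exI[of _ "add_mset (Glue x y) D"] exI[of _ "{#}"]) auto
  qed
qed

text \<open>Level by level, all but at most one item copy are glued in pairs and pushed one level
  up, at the cost of a factor \<open>c\<close> per round. Nothing limits the copies that accumulate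
  on the top level, so the conclusion bounds the copies only for
  \<open>k < \<kappa>\<close>.\<close>

lemma gluing_rounds:
  fixes J U :: "nat \<Rightarrow> 'a item set"
  assumes "J 0 = U 0" "0 \<le> c" "c \<le> 1"
    and nonneg_J: "\<And>k x. k \<le> \<kappa> \<Longrightarrow> x \<in> J k \<Longrightarrow> 0 \<le> item_val s x \<and> 0 \<le> item_val p x"
    and nonneg_U: "\<And>k x. k \<le> \<kappa> \<Longrightarrow> x \<in> U k \<Longrightarrow> 0 \<le> item_val s x \<and> 0 \<le> item_val p x"
    and disj: "\<And>i j. i < j \<Longrightarrow> j \<le> \<kappa> \<Longrightarrow> J i \<inter> J j = {}"
    and replace: "\<And>k x. k < \<kappa> \<Longrightarrow> x \<in> U (k + 1) \<union> glued_pairs s (J k) \<Longrightarrow>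
      \<exists>z\<in>J (k + 1). item_val s z \<le> item_val s x \<and> c * item_val p x \<le> item_val p z"
    and M: "set_mset M \<subseteq> (\<Union>k\<le>\<kappa>. U k)" "mset_val (item_val s) M \<le> 1"
  obtains N where "set_mset N \<subseteq> (\<Union>k\<le>\<kappa>. J k)" "\<And>k. k < \<kappa> \<Longrightarrow> copies_from (J k) N \<le> 1"
    "mset_val (item_val s) N \<le> mset_val (item_val s) M"
    "c ^ \<kappa> * mset_val (item_val p) M \<le> mset_val (item_val p) N"
proof -
  \<comment> \<open>Invariant after \<open>k\<close> rounds: \<open>A\<close> is the finished part
    below level \<open>k\<close>, \<open>B\<close> the unrestricted part on level \<open>k\<close>,
    and \<open>C\<close> the untouched items destined for higher levels.\<close>
  have "\<exists>A B C. set_mset A \<subseteq> (\<Union>j<k. J j) \<and> (\<forall>j<k. copies_from (J j) A \<le> 1) \<and>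
      set_mset B \<subseteq> J k \<and> set_mset C \<subseteq> (\<Union>j\<in>{k<..\<kappa>}. U j) \<and>
      mset_val (item_val s) (A + B + C) \<le> mset_val (item_val s) M \<and>
      c ^ k * mset_val (item_val p) M \<le> mset_val (item_val p) (A + B + C)"
    if "k \<le> \<kappa>" for k
    using that
  proof (induction k)
    case 0
    have "set_mset (filter_mset (\<lambda>x. x \<notin> U 0) M) \<subseteq> (\<Union>j\<in>{0<..\<kappa>}. U j)"
    proof
      fix x assume "x \<in># filter_mset (\<lambda>x. x \<notin> U 0) M"
      moreover from this obtain j where "j \<le> \<kappa>" "x \<in> U j" using M(1) by auto
      ultimately show "x \<in> (\<Union>j\<in>{0<..\<kappa>}. U j)" by (intro UN_I[of j]) (auto intro!: gr0I)
    qed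
    thus ?case
      using mset_val_filter_split[of _ M "\<lambda>x. x \<in> U 0"] assms(1)
      by (intro exI[of _ "{#}"] exI[of _ "filter_mset (\<lambda>x. x \<in> U 0) M"]
          exI[of _ "filter_mset (\<lambda>x. x \<notin> U 0) M"]) auto
  next
    case (Suc k)
    hence k: "k < \<kappa>" by simp
    from Suc obtain A B C where
      A: "set_mset A \<subseteq> (\<Union>j<k. J j)" "\<And>j. j < k \<Longrightarrow> copies_from (J j) A \<le> 1"
      and B: "set_mset B \<subseteq> J k" and C: "set_mset C \<subseteq> (\<Union>j\<in>{k<..\<kappa>}. U j)"
      and sz: "mset_val (item_val s) (A + B + C) \<le> mset_val (item_val s) M"
      and pr: "c ^ k * mset_val (item_val p) M \<le> mset_val (item_val p) (A + B + C)"
      by auto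
    \<comment> \<open>\<open>C1\<close> enters in this round together with the glued pairs;
      \<open>C2\<close> waits.\<close>
    define C1 C2 where "C1 = filter_mset (\<lambda>x. x \<in> U (k + 1)) C"
      and "C2 = filter_mset (\<lambda>x. x \<notin> U (k + 1)) C"
    have C12: "mset_val f C = mset_val f C1 + mset_val f C2" for f
      unfolding C1_def C2_def by (rule mset_val_filter_split)
    have C1: "set_mset C1 \<subseteq> U (k + 1)" by (auto simp: C1_def)
    have C2: "set_mset C2 \<subseteq> (\<Union>j\<in>{Suc k<..\<kappa>}. U j)"
    proof
      fix x assume "x \<in># C2"
      hence "x \<in> (\<Union>j\<in>{k<..\<kappa>}. U j)" "x \<notin> U (k + 1)"
        using C by (auto simp: C2_def)
      then obtain j where j: "k < j" "j \<le> \<kappa>" "x \<in> U j" by auto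
      with \<open>x \<notin> U (k + 1)\<close> have "j \<noteq> k + 1" by auto
      with j show "x \<in> (\<Union>j\<in>{Suc k<..\<kappa>}. U j)" by (intro UN_I[of j]) auto
    qed
    have nonneg: "0 \<le> item_val s x \<and> 0 \<le> item_val p x" if "x \<in># A + B + C" for x
    proof -
      have "(\<Union>j<k. J j) \<subseteq> (\<Union>j\<le>\<kappa>. J j)" "J k \<subseteq> (\<Union>j\<le>\<kappa>. J j)"
        "(\<Union>j\<in>{k<..\<kappa>}. U j) \<subseteq> (\<Union>j\<le>\<kappa>. U j)"
        using k by (intro UN_mono UN_upper; auto)+
      with A(1) B C have "set_mset A \<subseteq> (\<Union>j\<le>\<kappa>. J j)" "set_mset B \<subseteq> (\<Union>j\<le>\<kappa>. J j)"
        "set_mset C \<subseteq> (\<Union>j\<le>\<kappa>. U j)"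
        by (meson order.trans)+
      hence "x \<in> (\<Union>j\<le>\<kappa>. J j) \<or> x \<in> (\<Union>j\<le>\<kappa>. U j)"
        using that by (auto simp del: UN_iff)
      thus ?thesis using nonneg_J nonneg_U by blast
    qed
    \<comment> \<open>Dropping \<open>A\<close> and \<open>C\<close> can only decrease the size, so
      \<open>B\<close> alone satisfies the capacity bound required for pairing.\<close>
    have "0 \<le> mset_val (item_val s) A" "0 \<le> mset_val (item_val s) C"
      using nonneg by (auto intro!: mset_val_nonneg)
    hence "mset_val (item_val s) B \<le> 1" using sz M(2) by simp
    from mset_pairing[OF _ B this] nonneg_J k obtain D R where
      D: "set_mset D \<subseteq> glued_pairs s (J k)" and R: "set_mset R \<subseteq> J k" "size R \<le> 1"
      and DR: "\<And>f. mset_val (item_val f) (D + R) = mset_val (item_val f) B"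
      by (metis less_imp_le)
    obtain N where N: "set_mset N \<subseteq> J (k + 1)"
      "mset_val (item_val s) N \<le> mset_val (item_val s) (D + C1)"
      "c * mset_val (item_val p) (D + C1) \<le> mset_val (item_val p) N"
    proof (rule mset_replace)
      fix x assume "x \<in># D + C1"
      hence "x \<in> U (k + 1) \<union> glued_pairs s (J k)" using D C1 by auto
      from replace[OF k this] show "\<exists>z\<in>J (k + 1). item_val s z \<le> item_val s x \<and>
        c * item_val p x \<le> item_val p z" .
    qed
    let ?rest = "A + R + C2"
    \<comment> \<open>Only \<open>D + C1\<close> is exchanged; as the rest has nonnegative profit
      and \<open>c \<le> 1\<close>, the factor may be charged to everything.\<close>
    have "0 \<le> mset_val (item_val p) ?rest"
    proof (rule mset_val_nonneg)
      fix x assume "x \<in># ?rest"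
      hence "x \<in># A + B + C \<or> x \<in> J k" using R by (auto simp: C2_def)
      thus "0 \<le> item_val p x" using nonneg nonneg_J[of k] k by auto
    qed
    hence "c * mset_val (item_val p) ?rest \<le> 1 * mset_val (item_val p) ?rest"
      using assms(3) by (intro mult_right_mono)
    hence "c * mset_val (item_val p) (A + B + C) \<le> mset_val (item_val p) ((A + R) + N + C2)"
      using N(3) DR[of p] C12[of "item_val p"] by (simp add: algebra_simps flip: DR)
    moreover have "c * (c ^ k * mset_val (item_val p) M) \<le> c * mset_val (item_val p) (A + B + C)"
      using pr assms(2) by (intro mult_left_mono)
    ultimately have pr': "c ^ Suc k * mset_val (item_val p) M
        \<le> mset_val (item_val p) ((A + R) + N + C2)" by (simp add: mult.assoc)
    have sz': "mset_val (item_val s) ((A + R) + N + C2) \<le> mset_val (item_val s) M"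
      using N(2) DR[of s] C12[of "item_val s"] sz by simp
    \<comment> \<open>By disjointness of the levels, level \<open>k\<close> receives only the single
      leftover in \<open>R\<close>, and \<open>R\<close> adds nothing below it.\<close>
    have copies: "copies_from (J j) (A + R) \<le> 1" if "j < Suc k" for j
    proof (cases "j = k")
      case True
      have "copies_from (J k) A = 0"
        unfolding copies_from_eq_0_iff
      proof (rule ccontr)
        assume "set_mset A \<inter> J k \<noteq> {}"
        then obtain x where "x \<in># A" "x \<in> J k" by blast
        moreover from this obtain j where "j < k" "x \<in> J j" using A(1) by blast
        ultimately show False using disj[of j k] k by auto
      qed
      thus ?thesis using True R(2) copies_from_le_size[of "J k" R] by simp
    next
      case False
      hence "j < k" using that by simp
      moreover from this have "copies_from (J j) R = 0"
        unfolding copies_from_eq_0_iff using R(1) disj[of j k] k by auto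
      ultimately show ?thesis using A(2) by simp
    qed
    have "set_mset (A + R) \<subseteq> (\<Union>j<Suc k. J j)"
      using A(1) R(1) unfolding lessThan_Suc UN_insert set_mset_union by blast
    thus ?case using copies pr' sz' N(1) C2
      by (intro exI[of _ "A + R"] exI[of _ N] exI[of _ C2]) auto
  qed
  from this[of \<kappa>] obtain A B where
    A: "set_mset A \<subseteq> (\<Union>j<\<kappa>. J j)" "\<And>j. j < \<kappa> \<Longrightarrow> copies_from (J j) A \<le> 1"
    and B: "set_mset B \<subseteq> J \<kappa>"
    and val: "mset_val (item_val s) (A + B) \<le> mset_val (item_val s) M"
      "c ^ \<kappa> * mset_val (item_val p) M \<le> mset_val (item_val p) (A + B)"
    by auto
  have "copies_from (J j) B = 0" if "j < \<kappa>" for j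
    unfolding copies_from_eq_0_iff using B disj[of j \<kappa>] that by auto
  moreover have "set_mset (A + B) \<subseteq> (\<Union>k\<le>\<kappa>. J k)" 
    using A(1) B unfolding lessThan_Suc_atMost[symmetric] lessThan_Suc UN_insert set_mset_union
    by blast
  ultimately show thesis using that[of "A + B"] A(2) val by auto
qed

section \<open>Profit bounds by level and by efficiency\<close>

text \<open>The bound is the geometric sum of \<open>2 ^ (k + 1) * T\<close> over
  \<open>k < n\<close>; the induction splits off level \<open>n\<close>.\<close>

lemma one_per_level_profit_le:
  assumes "0 \<le> T" "\<And>k x. k < n \<Longrightarrow> x \<in> J k \<Longrightarrow> p x \<le> 2 ^ (k + 1) * T"
    "set_mset N \<subseteq> (\<Union>k<n. J k)" "\<And>k. k < n \<Longrightarrow> copies_from (J k) N \<le> 1"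
  shows "mset_val p N \<le> (2 ^ (n + 1) - 2) * T"
  using assms(2-4)
proof (induction n arbitrary: N)
  case 0
  thus ?case by simp
next
  case (Suc n)
  let ?F = "filter_mset (\<lambda>x. x \<in> J n) N" and ?F' = "filter_mset (\<lambda>x. x \<notin> J n) N"
  have "mset_val p ?F \<le> mset_val (\<lambda>_. 2 ^ (n + 1) * T) ?F"
    using Suc.prems(1) by (intro mset_val_mono) auto
  also have "\<dots> \<le> 2 ^ (n + 1) * T * 1"
    unfolding mset_val_const
    using Suc.prems(3)[of n] assms(1) by (intro mult_left_mono) (auto simp: copies_from_def)
  finally have 1: "mset_val p ?F \<le> 2 ^ (n + 1) * T" by simp
  have "mset_val p ?F' \<le> (2 ^ (n + 1) - 2) * T"
  proof (rule Suc.IH)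
    show "copies_from (J k) ?F' \<le> 1" if "k < n" for k
      using Suc.prems(3)[of k] copies_from_filter_le[of "J k" _ N] that order.trans by fastforce
    show "set_mset ?F' \<subseteq> (\<Union>k<n. J k)"
      using Suc.prems(2) unfolding lessThan_Suc UN_insert by auto
  qed (use Suc.prems(1) in auto)
  with 1 show ?case
    using mset_val_filter_split[of p N "\<lambda>x. x \<in> J n"] by (simp add: algebra_simps)
qed

text \<open>At the efficiency of \<open>b\<close>, the size of \<open>M\<close> would yield at least
  the profit of \<open>M\<close>. Rounding the fractional number of copies down loses at most one
  copy.\<close>

lemma mset_le_copies_of_most_efficient:
  assumes "is_arg_max (\<lambda>a. p a / s a) (\<lambda>a. a \<in> A) b"
    "\<And>a. a \<in> A \<Longrightarrow> 0 < s a" "0 \<le> p b" "set_mset M \<subseteq> A"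
  shows "\<exists>n. real n * s b \<le> mset_val s M \<and> mset_val p M - p b \<le> real n * p b"
proof -
  have b: "b \<in> A" "0 < s b" using assms by (auto simp: is_arg_max_def)
  have eff: "p a \<le> p b / s b * s a" if "a \<in> A" for a
  proof -
    have "p a / s a \<le> p b / s b" using assms(1) that by (auto simp: is_arg_max_def not_less)
    thus ?thesis using assms(2)[OF that] by (simp add: field_simps)
  qed
  have "mset_val p M \<le> mset_val (\<lambda>a. p b / s b * s a) M"
    using assms(4) eff by (intro mset_val_mono) auto
  hence pM: "mset_val p M \<le> p b * (mset_val s M / s b)"
    unfolding mset_val_cmult by simp
  define n where "n = nat \<lfloor>mset_val s M / s b\<rfloor>"
  have "0 \<le> mset_val s M" using assms by (intro mset_val_nonneg) (auto simp: less_imp_le)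
  hence "0 \<le> mset_val s M / s b" using b by simp
  hence n: "real n \<le> mset_val s M / s b" "mset_val s M / s b \<le> real n + 1"
    unfolding n_def by linarith+
  have "p b * (mset_val s M / s b) \<le> p b * (real n + 1)"
    using n assms(3) by (intro mult_left_mono)
  with pM have "mset_val p M - p b \<le> real n * p b" by (simp add: algebra_simps)
  with n b show ?thesis by (intro exI[of _ n]) (auto simp: field_simps)
qed

lemma ex_is_arg_max_if_finite:
  fixes f :: "'b \<Rightarrow> real"
  assumes "finite {x. Q x}" "Q x0"
  obtains x where "is_arg_max f Q x" "f x0 \<le> f x"
proof -
  have "Max (f ` {x. Q x}) \<in> f ` {x. Q x}" using assms by (intro Max_in) auto
  then obtain x where x: "Q x" "f x = Max (f ` {x. Q x})" by auto
  have "f y \<le> f x" if "Q y" for y using that assms x by (auto intro: Max_ge)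
  hence "is_arg_max f Q x" "f x0 \<le> f x"
    using x assms by (auto simp: is_arg_max_def not_less)
  with that show thesis .
qed

section \<open>Structured solutions compared with the unrestricted optimum\<close>

theorem theorem6:
  fixes p s :: "'a \<Rightarrow> real"
    and I I_L I_S I_Lred :: "'a set"
    and a_me a_eff :: 'a
    and \<kappa> m :: nat
    and \<epsilon> P0 T K :: real
    and r :: "nat \<Rightarrow> nat \<Rightarrow> 'a option"
    and g :: "nat \<Rightarrow> nat \<Rightarrow> 'a item option"
    and Ik :: "nat \<Rightarrow> 'a set"
    and J :: "nat \<Rightarrow> 'a item set"
    and G E :: "'a item set"
    and feasible :: "'a item multiset \<Rightarrow> bool"
  assumes "finite I"
    and "\<And>a. a \<in> I \<Longrightarrow> 0 < p a \<and> p a \<le> 1"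
    and "\<And>a. a \<in> I \<Longrightarrow> 0 < s a \<and> s a \<le> 1"
    and "\<epsilon> = 1 / 2 ^ (\<kappa> - 1)" and "\<epsilon> \<le> 1 / 4"
    and "is_arg_max (\<lambda>a. p a / s a) (\<lambda>a. a \<in> I) a_me"
    and "P0 = p a_me * of_int \<lfloor>1 / s a_me\<rfloor>"
    and "T = 1 / 2 * \<epsilon> * P0"
    and "K = 1 / 4 * (1 / (real \<kappa> + 1)) * \<epsilon> * T"
    and "\<forall>a\<in>I. p a \<noteq> 2 * P0"
    and "I_L = {a \<in> I. p a \<ge> T}"
    and "I_S = I - I_L"
    and "I_S \<noteq> {}"
    and "is_arg_max (\<lambda>a. p a / s a) (\<lambda>a. a \<in> I_S) a_eff"
    \<comment> \<open>the reduced large items\<close>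
    and "\<And>k \<gamma>. k \<le> \<kappa> \<Longrightarrow> \<gamma> < 2 ^ (\<kappa> + 1) * (\<kappa> + 1) \<Longrightarrow>
           min_size_choice s {a \<in> I_L. p a \<in> profit_sublevel T K k \<gamma>} (r k \<gamma>)"
    and "I_Lred = {a. \<exists>k\<le>\<kappa>. \<exists>\<gamma><2 ^ (\<kappa> + 1) * (\<kappa> + 1). r k \<gamma> = Some a}"
    and "\<And>k. k \<le> \<kappa> \<Longrightarrow> Ik k = {a \<in> I_Lred. p a \<in> profit_level T k}"
    \<comment> \<open>the levels obtained by gluing\<close>
    and "J 0 = Orig ` Ik 0"
    and "\<And>k \<gamma>. k < \<kappa> \<Longrightarrow> \<gamma> < 2 ^ (\<kappa> + 1) * (\<kappa> + 1) \<Longrightarrow>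
           min_size_choice (item_val s)
             {x \<in> Orig ` Ik (k + 1) \<union> glued_pairs s (J k).
                item_val p x \<in> profit_sublevel T K (k + 1) \<gamma>}
             (g (k + 1) \<gamma>)"
    and "\<And>k. k < \<kappa> \<Longrightarrow>
           J (k + 1) = {x. \<exists>\<gamma><2 ^ (\<kappa> + 1) * (\<kappa> + 1). g (k + 1) \<gamma> = Some x}"
    and "G = (\<Union>k\<le>\<kappa>. J k)"
    \<comment> \<open>the glued copies of the efficient small item, if they fit\<close>
    and "m = nat \<lceil>(P0 / 4) / p a_eff\<rceil>"
    and "E = (if real m * s a_eff \<le> 1 then {Copies m (Orig a_eff)} else {})"
    \<comment> \<open>every optimal solution uses at most one item copy from the topmost level\<close>
    and "\<And>M. feasible M \<longleftrightarrow>
           set_mset M \<subseteq> G \<union> {Orig a_eff} \<and> mset_val (item_val s) M \<le> 1 \<and>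
           (\<forall>k<\<kappa>. copies_from (J k) M \<le> 1)"
    and "\<And>M. is_arg_max (mset_val (item_val p)) feasible M \<Longrightarrow> copies_from (J \<kappa>) M \<le> 1"
  shows "\<exists>v. 0 \<le> v \<and> v \<le> 1 \<and>
           opt_structured p s \<kappa> J E v + opt p s (1 - v) {a_eff}
             \<ge> (1 - \<epsilon> / 4 * (1 / (log 2 (2 / \<epsilon>) + 1))) ^ (\<kappa> + 1) * opt p s 1 I - T"
proof -
  note finI = assms(1) and me = assms(6) and P0 = assms(7) and T = assms(8)
    and IL = assms(11) and IS = assms(12) and eff = assms(14) and red_choice = assms(15)
    and ILred = assms(16) and Ik = assms(17) and J0 = assms(18) and J_choice = assms(19)
    and JSuc = assms(20) and G = assms(21) and m = assms(22) and E = assms(23)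
    and feasible = assms(24) and top_level = assms(25)
  have pos: "0 < p a" "0 < s a" "s a \<le> 1" if "a \<in> I" for a using assms(2,3) that by auto

  \<comment> \<open>Makes the natural-number differences \<open>\<kappa> - 1\<close> and
    \<open>\<kappa> - 2\<close> genuine.\<close>
  have kappa3: "3 \<le> \<kappa>"
  proof (rule ccontr)
    assume "\<not> 3 \<le> \<kappa>"
    hence "(2::real) ^ (\<kappa> - 1) \<le> 2 ^ 1" by (intro power_increasing) auto
    hence "1 / 2 \<le> (1::real) / 2 ^ (\<kappa> - 1)" by (intro divide_left_mono) auto
    thus False using assms(4,5) by simp
  qed
  hence kappa: "\<kappa> = Suc (Suc (Suc (\<kappa> - 3)))" by simp
  have pow: "(2::real) ^ \<kappa> = 2 * 2 ^ (\<kappa> - 1)" by (subst kappa, subst (2) kappa) simp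
  have eps: "0 < \<epsilon>" "\<epsilon> * 2 ^ (\<kappa> - 1) = 1" using assms(4) by simp_all
  define \<delta> where "\<delta> = \<epsilon> / 4 * (1 / (real \<kappa> + 1))"
  \<comment> \<open>Identifies \<open>1 - \<delta>\<close> with the base of the power in the
    conclusion, as \<open>2 / \<epsilon> = 2 ^ \<kappa>\<close>.\<close>
  have log: "log 2 (2 / \<epsilon>) = real \<kappa>"
    using assms(4) by (simp add: pow[symmetric] log_nat_power del: One_nat_def)
  have "\<delta> \<le> \<epsilon> / 4 * 1" unfolding \<delta>_def using eps by (intro mult_left_mono) auto
  hence delta: "0 < \<delta>" "\<delta> \<le> 1" using eps assms(5) by (auto simp: \<delta>_def)

  have me_I: "a_me \<in> I" using me by (simp add: is_arg_max_def)
  define q where "q = nat \<lfloor>1 / s a_me\<rfloor>"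
  have inv: "1 \<le> 1 / s a_me" using pos[OF me_I] by simp
  \<comment> \<open>The last bound comes from \<open>1 / s a_me < q + 1\<close> and
    \<open>1 \<le> q\<close>.\<close>
  hence q: "real q = of_int \<lfloor>1 / s a_me\<rfloor>" "1 \<le> real q" "real q \<le> 1 / s a_me" "1 / s a_me < 2 * real q"
  proof -
    have "1 \<le> \<lfloor>1 / s a_me\<rfloor>" using inv by simp
    thus "real q = of_int \<lfloor>1 / s a_me\<rfloor>" "1 \<le> real q"
      "real q \<le> 1 / s a_me" "1 / s a_me < 2 * real q"
      unfolding q_def by linarith+
  qed
  have P0q: "P0 = real q * p a_me" using P0 q by simp
  have P0_pos: "0 < P0" using P0q q pos[OF me_I] by simp
  have T_pos: "0 < T" unfolding T using eps(1) P0_pos by simp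
  have T2: "2 ^ (\<kappa> - 1) * T = P0 / 2" "2 ^ \<kappa> * T = P0"
  proof -
    have "2 ^ (\<kappa> - 1) * T = (\<epsilon> * 2 ^ (\<kappa> - 1)) * (P0 / 2)" unfolding T by (simp only: mult_ac) simp
    thus "2 ^ (\<kappa> - 1) * T = P0 / 2" by (simp only: eps(2) mult_1)
    thus "2 ^ \<kappa> * T = P0" by (simp add: pow)
  qed
  have K: "K = \<delta> * T" using assms(9) by (simp add: \<delta>_def)
  \<comment> \<open>The number of sublevels per level; \<open>n * \<delta> = 1\<close> says that
    they tile it exactly.\<close>
  define n where "n = 2 ^ (\<kappa> + 1) * (\<kappa> + 1)"
  have "real n * \<delta> = 1"
  proof -
    have "real n * \<delta> = (\<epsilon> * 2 ^ (\<kappa> - 1)) * ((real \<kappa> + 1) / (real \<kappa> + 1))"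
      by (simp add: n_def \<delta>_def pow field_simps)
    thus ?thesis using eps by simp
  qed
  hence nK: "real n * K = T" by (simp add: K)
  have K_nonneg: "0 \<le> K" using K delta T_pos by simp

  \<comment> \<open>No item exceeds the profit of a knapsack filled fractionally with
    \<open>a_me\<close>, which is below \<open>2 * P0\<close>. So levels \<open>0\<close> to
    \<open>\<kappa>\<close> catch every large item.\<close>
  have large_lt: "p a < 2 ^ (\<kappa> + 1) * T" if "a \<in> I" for a
  proof -
    have "p a / s a \<le> p a_me / s a_me" using me that by (auto simp: is_arg_max_def not_less)
    hence "p a \<le> p a_me / s a_me * s a" using pos[OF that] by (simp add: field_simps)
    also have "\<dots> \<le> p a_me / s a_me * 1"
      using pos[OF that] pos[OF me_I] by (intro mult_left_mono) auto
    also have "\<dots> = p a_me * (1 / s a_me)" by simp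
    also have "\<dots> < p a_me * (2 * real q)"
      using q pos[OF me_I] by (intro mult_strict_left_mono) auto
    finally have "p a < 2 * P0" using P0q by (simp add: mult_ac)
    thus ?thesis using T2(2) by simp
  qed

  have eff_I: "a_eff \<in> I" and eff_T: "p a_eff < T"
    using eff IS IL by (auto simp: is_arg_max_def)
  note eff_pos = pos[OF eff_I]

  have ILred_level: "\<exists>k\<le>\<kappa>. a \<in> Ik k" if "a \<in> I_Lred" for a
  proof -
    from that obtain k \<gamma> where k: "k \<le> \<kappa>" "\<gamma> < n" "r k \<gamma> = Some a"
      unfolding ILred n_def by blast
    with red_choice[of k \<gamma>] have "p a \<in> profit_level T k"
      using min_size_choiceD(2)[OF K_nonneg nK k(2)] by (simp add: n_def)
    with k that show ?thesis using Ik by auto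
  qed
  have Ik_sub: "Ik k \<subseteq> I_L" "p ` Ik k \<subseteq> profit_level T k" if "k \<le> \<kappa>" for k
  proof -
    have "I_Lred \<subseteq> I_L"
    proof
      fix a assume "a \<in> I_Lred"
      then obtain k \<gamma> where k: "k \<le> \<kappa>" "\<gamma> < n" "r k \<gamma> = Some a"
        unfolding ILred n_def by blast
      with red_choice[of k \<gamma>] show "a \<in> I_L"
        using min_size_choiceD(1)[OF K_nonneg nK k(2)] by (simp add: n_def)
    qed
    thus "Ik k \<subseteq> I_L" "p ` Ik k \<subseteq> profit_level T k" using Ik[OF that] by auto
  qed

  \<comment> \<open>Properties of the glued levels\<close>
  have J_step: "x \<in> Orig ` Ik (k + 1) \<union> glued_pairs s (J k)" "item_val p x \<in> profit_level T (k + 1)"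
    if "k < \<kappa>" "x \<in> J (k + 1)" for k x
  proof -
    from that JSuc[of k] obtain \<gamma> where \<gamma>: "\<gamma> < n" "g (k + 1) \<gamma> = Some x"
      unfolding n_def by blast
    with J_choice[of k \<gamma>] that have "min_size_choice (item_val s)
      {y \<in> Orig ` Ik (k + 1) \<union> glued_pairs s (J k). item_val p y \<in> profit_sublevel T K (k + 1) \<gamma>}
      (Some x)"
      unfolding n_def by metis
    from min_size_choiceD[OF K_nonneg nK \<gamma>(1) this]
    show "x \<in> Orig ` Ik (k + 1) \<union> glued_pairs s (J k)"
      "item_val p x \<in> profit_level T (k + 1)" .
  qed
  have J_level: "item_val p x \<in> profit_level T k" if "k \<le> \<kappa>" "x \<in> J k" for k x
  proof (cases k)
    case 0
    thus ?thesis using that J0 Ik_sub(2)[of 0] by auto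
  next
    case (Suc j)
    thus ?thesis using that J_step(2)[of j x] by simp
  qed
  \<comment> \<open>The absence of \<open>Copies\<close> later separates the levels from
    \<open>E\<close>.\<close>
  have J_basic: "finite (J k) \<and> (\<forall>x\<in>J k. 0 < item_val s x \<and> (\<forall>i y. x \<noteq> Copies i y))"
    if "k \<le> \<kappa>" for k
    using that
  proof (induction k)
    case 0
    have "Ik 0 \<subseteq> I" using Ik_sub(1)[of 0] IL by auto
    thus ?case using J0 pos finI by (auto intro: finite_subset)
  next
    case (Suc k)
    have "J (k + 1) \<subseteq> (\<lambda>\<gamma>. the (g (k + 1) \<gamma>)) ` {..<n}"
      using JSuc[of k] Suc.prems by (force simp: n_def)
    hence "finite (J (Suc k))" using finite_subset by fastforce
    moreover have "0 < item_val s x \<and> (\<forall>i y. x \<noteq> Copies i y)" if "x \<in> J (Suc k)" for x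
    proof -
      have IH: "0 < item_val s y" if "y \<in> J k" for y using Suc that by simp
      have "Ik (k + 1) \<subseteq> I" using Ik_sub(1)[of "k + 1"] Suc.prems IL by auto
      moreover have "x \<in> Orig ` Ik (k + 1) \<union> glued_pairs s (J k)"
        using J_step(1)[of k x] that Suc.prems by simp
      ultimately show ?thesis
        using pos(2) IH by (auto simp: glued_pairs_def intro!: add_pos_pos)
    qed
    ultimately show ?case by blast
  qed
  have level_pos: "0 < y" if "y \<in> profit_level T k" for y k
    using that T_pos by (auto simp: profit_level_def intro: less_le_trans[of _ "2 ^ k * T"])
  have disj: "J i \<inter> J j = {}" if "i < j" "j \<le> \<kappa>" for i j
    using J_level[of i] J_level[of j] profit_level_disjoint[OF T_pos that(1)] that by auto
  have eff_notin_G: "Orig a_eff \<notin> G"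
  proof
    assume "Orig a_eff \<in> G"
    then obtain k where "k \<le> \<kappa>" "Orig a_eff \<in> J k" using G by auto
    hence "2 ^ k * T \<le> p a_eff" using J_level[of k "Orig a_eff"] by (simp add: profit_level_def)
    moreover have "1 * T \<le> 2 ^ k * T" using T_pos by (intro mult_right_mono) auto
    ultimately show False using eff_T by simp
  qed

  have replace: "\<exists>z\<in>J (k + 1). item_val s z \<le> item_val s x \<and> (1 - \<delta>) * item_val p x \<le> item_val p z"
    if k: "k < \<kappa>" and x: "x \<in> Orig ` Ik (k + 1) \<union> glued_pairs s (J k)" for k x
  proof -
    \<comment> \<open>The endpoints double from one level to the next, so two profits of level
      \<open>k\<close> add up to a profit of level \<open>k + 1\<close>.\<close>
    have lev: "item_val p x \<in> profit_level T (k + 1)"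
      using x
    proof
      assume "x \<in> Orig ` Ik (k + 1)"
      thus ?thesis using Ik_sub(2)[of "k + 1"] k by auto
    next
      assume "x \<in> glued_pairs s (J k)"
      then obtain y z where "x = Glue y z" "y \<in> J k" "z \<in> J k" by (auto simp: glued_pairs_def)
      thus ?thesis
        using J_level[of k y] J_level[of k z] k by (auto simp: profit_level_def algebra_simps)
    qed
    from min_size_choice_replace[OF delta(1) T_pos K nK J_choice[OF k] x lev]
    obtain \<gamma> z where "\<gamma> < n" "g (k + 1) \<gamma> = Some z" "item_val s z \<le> item_val s x"
      "(1 - \<delta>) * item_val p x \<le> item_val p z"
      by (auto simp: n_def)
    thus ?thesis using JSuc[OF k] by (auto simp: n_def)
  qed
  have reduce: "\<exists>z \<in> (\<Union>k\<le>\<kappa>. Orig ` Ik k). item_val s z \<le> s a \<and> (1 - \<delta>) * p a \<le> item_val p z"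
    if a: "a \<in> I_L" for a
  proof -
    have "T \<le> p a" "p a < 2 ^ (\<kappa> + 1) * T" using a IL large_lt by auto
    then obtain k where k: "k \<le> \<kappa>" "p a \<in> profit_level T k" using profit_level_cover by blast
    from min_size_choice_replace[OF delta(1) T_pos K nK red_choice[OF k(1)] a k(2)]
    obtain \<gamma> z where \<gamma>: "\<gamma> < n" "r k \<gamma> = Some z" "s z \<le> s a" "(1 - \<delta>) * p a \<le> p z"
      by (auto simp: n_def)
    hence "z \<in> I_Lred" using k(1) unfolding ILred n_def by blast
    with ILred_level \<gamma> show ?thesis by fastforce
  qed

  \<comment> \<open>From an optimal solution to a feasible restricted one\<close>
  obtain X where X: "set_mset X \<subseteq> I" "mset_val s X \<le> 1" "mset_val p X = opt p s 1 I"
    using opt_attained[OF finI, of s 1 p] pos by auto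
  define XL XS where "XL = filter_mset (\<lambda>a. a \<in> I_L) X" and "XS = filter_mset (\<lambda>a. a \<notin> I_L) X"
  have X_split: "mset_val f X = mset_val f XL + mset_val f XS" for f
    unfolding XL_def XS_def by (rule mset_val_filter_split)
  have XS_sub: "set_mset XS \<subseteq> I_S" using X(1) IS by (auto simp: XS_def)
  have IS_pos: "0 < s a" if "a \<in> I_S" for a using that IS pos by auto
  have XS_nonneg: "0 \<le> mset_val s XS" "0 \<le> mset_val p XS"
    using XS_sub IS pos by (auto intro!: mset_val_nonneg simp: less_imp_le dest!: subsetD)
  obtain R where R: "set_mset R \<subseteq> (\<Union>k\<le>\<kappa>. Orig ` Ik k)"
    "mset_val (item_val s) R \<le> mset_val s XL" "(1 - \<delta>) * mset_val p XL \<le> mset_val (item_val p) R"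
    by (rule mset_replace[of XL "\<Union>k\<le>\<kappa>. Orig ` Ik k" "item_val s" s "1 - \<delta>" p "item_val p"])
      (use reduce in \<open>auto simp: XL_def\<close>)
  have R1: "mset_val (item_val s) R \<le> 1" using R(2) X(2) X_split[of s] XS_nonneg by simp
  obtain N where N: "set_mset N \<subseteq> (\<Union>k\<le>\<kappa>. J k)" "\<And>k. k < \<kappa> \<Longrightarrow> copies_from (J k) N \<le> 1"
    "mset_val (item_val s) N \<le> mset_val (item_val s) R"
    "(1 - \<delta>) ^ \<kappa> * mset_val (item_val p) R \<le> mset_val (item_val p) N"
  proof (rule gluing_rounds[of J "\<lambda>k. Orig ` Ik k" "1 - \<delta>" \<kappa> s p R])
    show "0 \<le> item_val s x \<and> 0 \<le> item_val p x" if "k \<le> \<kappa>" "x \<in> J k" for k x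
      using J_basic[OF that(1)] level_pos[OF J_level[OF that]] that by (auto simp: less_imp_le)
    show "0 \<le> item_val s x \<and> 0 \<le> item_val p x" if "k \<le> \<kappa>" "x \<in> Orig ` Ik k" for k x
      using Ik_sub(1)[OF that(1)] that pos IL by (auto simp: less_imp_le)
  qed (use J0 delta disj replace R R1 in auto)
  \<comment> \<open>Copies of \<open>a_eff\<close> take the room of the small items; the lost
    \<open>p a_eff < T\<close> is the source of the term \<open>- T\<close>.\<close>
  obtain c where c: "real c * s a_eff \<le> mset_val s XS" "mset_val p XS - p a_eff \<le> real c * p a_eff"
    using mset_le_copies_of_most_efficient[OF eff IS_pos _ XS_sub] eff_pos by auto

  let ?bound = "(1 - \<delta>) ^ (\<kappa> + 1) * opt p s 1 I - T"
  let ?M0 = "N + replicate_mset c (Orig a_eff)"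
  have "(1 - \<delta>) ^ (\<kappa> + 1) * mset_val p XL \<le> mset_val (item_val p) N"
  proof -
    have "(1 - \<delta>) ^ \<kappa> * ((1 - \<delta>) * mset_val p XL) \<le> (1 - \<delta>) ^ \<kappa> * mset_val (item_val p) R"
      using R(3) delta by (intro mult_left_mono) auto
    with N(4) show ?thesis by (simp add: mult.assoc mult.left_commute)
  qed
  moreover have "(1 - \<delta>) ^ (\<kappa> + 1) * mset_val p XS \<le> mset_val p XS"
    using XS_nonneg delta by (intro mult_left_le_one_le power_le_one) auto
  moreover have "(1 - \<delta>) ^ (\<kappa> + 1) * opt p s 1 I
      = (1 - \<delta>) ^ (\<kappa> + 1) * mset_val p XL + (1 - \<delta>) ^ (\<kappa> + 1) * mset_val p XS"
    unfolding X(3)[symmetric] X_split[of p] by (rule distrib_left)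
  moreover have "mset_val (item_val p) ?M0 = mset_val (item_val p) N + real c * p a_eff" by simp
  ultimately have M0_profit: "?bound \<le> mset_val (item_val p) ?M0"
    using c(2) eff_T by linarith
  have eff_notin_J: "Orig a_eff \<notin> J k" if "k \<le> \<kappa>" for k
    using eff_notin_G G that by auto
  have M0_feasible: "feasible ?M0"
    unfolding feasible
  proof (intro conjI allI impI)
    show "set_mset ?M0 \<subseteq> G \<union> {Orig a_eff}" using N(1) G by auto
    show "mset_val (item_val s) ?M0 \<le> 1" using N(3) R(2) c(1) X(2) X_split[of s] by simp
    fix k assume k: "k < \<kappa>"
    have "copies_from (J k) (replicate_mset c (Orig a_eff)) = 0"
      unfolding copies_from_eq_0_iff using eff_notin_J[of k] k by auto
    thus "copies_from (J k) ?M0 \<le> 1" using N(2)[OF k] by simp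
  qed

  \<comment> \<open>An optimal solution of the restricted problem\<close>
  have G_fin: "finite G" and G_pos: "\<And>x. x \<in> G \<Longrightarrow> 0 < item_val s x"
    using G J_basic by auto
  have "finite {M. set_mset M \<subseteq> G \<union> {Orig a_eff} \<and> mset_val (item_val s) M \<le> 1}"
    using G_fin G_pos eff_pos by (intro finite_bounded_multisets) auto
  hence "finite {M. feasible M}"
    by (rule finite_subset[rotated]) (auto simp: feasible)
  from ex_is_arg_max_if_finite[OF this M0_feasible, of "mset_val (item_val p)"]
  obtain M where M: "is_arg_max (mset_val (item_val p)) feasible M" "?bound \<le> mset_val (item_val p) M"
    using M0_profit by (metis order.trans)
  \<comment> \<open>For \<open>k = \<kappa>\<close> the copy bound is the assumption on optimal
    solutions, which is why \<open>?M0\<close> is replaced by an optimal \<open>M\<close>.\<close>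
  have M_sub: "set_mset M \<subseteq> G \<union> {Orig a_eff}" and M_size: "mset_val (item_val s) M \<le> 1"
    and M_copies: "\<And>k. k \<le> \<kappa> \<Longrightarrow> copies_from (J k) M \<le> 1"
    using M(1) feasible[of M] top_level[OF M(1)] by (auto simp: is_arg_max_def le_less)

  define L where "L = filter_mset (\<lambda>x. x \<noteq> Orig a_eff) M"
  define c' where "c' = count M (Orig a_eff)"
  have M_eq: "M = L + replicate_mset c' (Orig a_eff)"
    unfolding L_def c'_def by (rule multiset_eqI) auto
  have L_sub: "set_mset L \<subseteq> (\<Union>k\<le>\<kappa>. J k)" using M_sub G by (auto simp: L_def)
  have L_copies: "copies_from (J k) L \<le> 1" if "k \<le> \<kappa>" for k
    using M_copies[OF that] copies_from_filter_le[of "J k" _ M] order.trans unfolding L_def by blast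
  have L_nonneg: "0 \<le> mset_val (item_val s) L"
    using L_sub G_pos unfolding G[symmetric]
    by (intro mset_val_nonneg) (meson less_imp_le subsetD)
  have JE_fin: "finite ((\<Union>k\<le>\<kappa>. J k) \<union> E)" using G_fin G E by auto
  have "0 < (P0 / 4) / p a_eff" using P0_pos eff_pos by simp
  hence m_pos: "0 < m" unfolding m by linarith
  have JE_pos: "0 < item_val s x" if "x \<in> (\<Union>k\<le>\<kappa>. J k) \<union> E" for x
    using that G_pos G E m_pos eff_pos by (auto split: if_splits)
  have E_disj: "x \<notin> E" if "x \<in> J k" "k \<le> \<kappa>" for x k
    using J_basic[OF that(2)] that(1) E by (auto split: if_splits)
  have L_E: "copies_from E L = 0"
    unfolding copies_from_eq_0_iff using L_sub E_disj by auto
  have opt_eff: "real b * p a_eff \<le> opt p s (1 - v) {a_eff}" if "v + real b * s a_eff \<le> 1" for b v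
    using opt_ge_mset_val[of "{a_eff}" s "replicate_mset b a_eff" "1 - v" p] that eff_pos by auto

  \<comment> \<open>Choice of the capacity split\<close>
  have "\<exists>v. 0 \<le> v \<and> v \<le> 1 \<and> ?bound \<le> opt_structured p s \<kappa> J E v + opt p s (1 - v) {a_eff}"
  proof (cases "1 \<le> copies_from (J (\<kappa> - 2) \<union> J (\<kappa> - 1) \<union> J \<kappa>) L")
    case True
    \<comment> \<open>With an item on the top three levels, \<open>L\<close> is structured as it
      stands, and all copies of \<open>a_eff\<close> go into the remaining capacity.\<close>
    define v where "v = mset_val (item_val s) L"
    have "copies_from (J (\<kappa> - 2) \<union> J (\<kappa> - 1) \<union> J \<kappa> \<union> E) L \<ge> 1"
    proof -
      have "copies_from (J (\<kappa> - 2) \<union> J (\<kappa> - 1) \<union> J \<kappa> \<union> E) L \<noteq> 0"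
      proof -
        have "copies_from (J (\<kappa> - 2) \<union> J (\<kappa> - 1) \<union> J \<kappa>) L \<noteq> 0" using True by linarith
        thus ?thesis unfolding copies_from_eq_0_iff by blast
      qed
      thus ?thesis by simp
    qed
    hence "structured s \<kappa> J E v L"
      using L_sub L_copies L_E by (auto simp: structured_def v_def)
    from opt_structured_ge_mset_val[OF JE_fin JE_pos this]
    have "mset_val (item_val p) L \<le> opt_structured p s \<kappa> J E v" .
    moreover have "v + real c' * s a_eff \<le> 1" using M_size by (simp add: M_eq v_def)
    moreover from this have "real c' * p a_eff \<le> opt p s (1 - v) {a_eff}" by (rule opt_eff)
    moreover have "0 \<le> real c' * s a_eff" using eff_pos by simp
    ultimately show ?thesis
      using M(2) L_nonneg by (intro exI[of _ v]) (auto simp: M_eq v_def)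
  next
    case False
    hence no_top: "set_mset L \<inter> (J (\<kappa> - 2) \<union> J (\<kappa> - 1) \<union> J \<kappa>) = {}"
      by (simp flip: copies_from_eq_0_iff)
    have "set_mset L \<subseteq> (\<Union>k<\<kappa> - 2. J k)"
    proof
      fix x assume x: "x \<in># L"
      with L_sub obtain k where k: "k \<le> \<kappa>" "x \<in> J k" by auto
      with x no_top have "k \<noteq> \<kappa> - 2" "k \<noteq> \<kappa> - 1" "k \<noteq> \<kappa>" by auto
      with k show "x \<in> (\<Union>k<\<kappa> - 2. J k)" by (intro UN_I[of k]) auto
    qed
    \<comment> \<open>At most one item on each level below \<open>\<kappa> - 2\<close>; the bound
      equals \<open>P0 / 2 - 2 * T\<close>.\<close>
    hence "mset_val (item_val p) L \<le> (2 ^ (\<kappa> - 2 + 1) - 2) * T"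
    proof (rule one_per_level_profit_le[rotated 2])
      show "item_val p x \<le> 2 ^ (k + 1) * T" if "k < \<kappa> - 2" "x \<in> J k" for k x
      proof -
        have "k \<le> \<kappa>" using that(1) by simp
        from J_level[OF this that(2)] show ?thesis by (simp add: profit_level_def)
      qed
    qed (use T_pos L_copies in auto)
    also have "\<kappa> - 2 + 1 = \<kappa> - 1" using kappa3 by simp
    finally have L_profit: "mset_val (item_val p) L \<le> P0 / 2 - 2 * T"
      using T2(1) by (simp add: left_diff_distrib)
    have "P0 \<le> opt p s 1 I"
    proof -
      have "real q * s a_me \<le> 1" using q(3) pos[OF me_I] by (simp add: field_simps)
      thus ?thesis
        using opt_ge_mset_val[OF finI, of s "replicate_mset q a_me" 1 p] pos me_I P0q by auto
    qed
    \<comment> \<open>As \<open>(\<kappa> + 1) * \<delta> = \<epsilon> / 4\<close>, all rounds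
      together cost at most \<open>T / 2\<close> out of \<open>P0\<close>. Subtracting the bound for
      \<open>L\<close> leaves at least \<open>P0 / 2 + T / 2\<close> to the copies of
      \<open>a_eff\<close>.\<close>
    have "1 + real (\<kappa> + 1) * (- \<delta>) \<le> (1 + (- \<delta>)) ^ (\<kappa> + 1)"
      using delta by (intro Bernoulli_inequality) auto
    moreover have "real (\<kappa> + 1) * \<delta> = \<epsilon> / 4" by (simp add: \<delta>_def divide_simps)
    ultimately have "1 - \<epsilon> / 4 \<le> (1 - \<delta>) ^ (\<kappa> + 1)" by simp
    hence "(1 - \<epsilon> / 4) * P0 \<le> (1 - \<delta>) ^ (\<kappa> + 1) * opt p s 1 I"
      using \<open>P0 \<le> opt p s 1 I\<close> P0_pos delta by (intro mult_mono) auto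
    moreover have "(1 - \<epsilon> / 4) * P0 = P0 - T / 2" using T by (simp add: algebra_simps)
    ultimately have "P0 / 4 \<le> real c' * p a_eff"
      using M(2) L_profit T_pos P0_pos by (simp add: M_eq)
    hence "(P0 / 4) / p a_eff \<le> real c'" using eff_pos by (simp add: field_simps)
    hence mc: "m \<le> c'" unfolding m by linarith
    define b where "b = c' - m"
    have c'_eq: "real c' = real m + real b" using mc by (simp add: b_def)
    have size: "mset_val (item_val s) L + real m * s a_eff + real b * s a_eff \<le> 1"
      using M_size by (simp add: M_eq c'_eq algebra_simps)
    have nonneg: "0 \<le> real m * s a_eff" "0 \<le> real b * s a_eff" using eff_pos by auto
    define v where "v = mset_val (item_val s) L + real m * s a_eff"
    let ?C = "Copies m (Orig a_eff)"
    \<comment> \<open>The \<open>m\<close> copies fit because they are part of \<open>M\<close>; the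
      glued item then meets the lower bound on copies in \<open>structured\<close>.\<close>
    have E_eq: "E = {?C}" using E size L_nonneg nonneg by auto
    have "structured s \<kappa> J E v (add_mset ?C L)"
      unfolding structured_def
      using L_sub L_copies L_E E_eq E_disj by (auto simp: v_def)
    from opt_structured_ge_mset_val[OF JE_fin JE_pos this]
    have "mset_val (item_val p) L + real m * p a_eff \<le> opt_structured p s \<kappa> J E v"
      by (metis add.commute item_val.simps(1,3) mset_val_add)
    moreover have "real b * p a_eff \<le> opt p s (1 - v) {a_eff}"
      using size by (intro opt_eff) (simp add: v_def)
    ultimately show ?thesis
      using M(2) L_nonneg nonneg size
      by (intro exI[of _ v]) (auto simp: M_eq v_def c'_eq algebra_simps)
  qed
  thus ?thesis by (simp add: \<delta>_def log)
qed

end
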